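(* For any $n\in\mathbb{N}$, with $t:=\left\lfloor \frac{n}{6}+1\right\rfloor$, and any cograph $G$ on $n$ vertices, either $K_{t,t}\subseteq G$ or $K_{t,t}\subseteq\overline{G}$.
   Context: Graphs are finite and simple. A cograph is a graph with no induced path $P_4$ on four vertices. $\overline{G}$ is the complement of $G$. $K_{t,t}$ is the complete bipartite graph with both parts of size $t$; $K_{t,t}\subseteq G$ means that $G$ has a (not necessarily induced) subgraph isomorphic to $K_{t,t}$. "Either ... or" is inclusive.
   Formalization: The formal statement assumes n ≥ 2; for n = 0 and n = 1 the claim is false, since then t = 1 and K_{1,1} has two vertices, more than G or its complement has. *)

theory Defs
  imports Complex_Main "Graph_Theory.Graph_Theory"
begin

text \<open>
  Finite simple graphs are the locale \<open>pair_graph\<close>: a finite vertex set together with a symmetric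
  irreflexive relation on it. An undirected edge \<open>uv\<close> is the pair of arcs \<open>(u,v)\<close>, \<open>(v,u)\<close>.
\<close>

definition is_P4 :: "('a,'b) pre_digraph \<Rightarrow> bool" where
  "is_P4 H \<longleftrightarrow> graph H \<and> (\<exists>a b c d. distinct [a, b, c, d] \<and> verts H = {a, b, c, d} \<and>
     arcs_ends H = {(a, b), (b, a), (b, c), (c, b), (c, d), (d, c)})"

definition cograph :: "'a pair_pre_digraph \<Rightarrow> bool" where
  "cograph G \<longleftrightarrow> pair_graph G \<and> \<not> (\<exists>H. induced_subgraph H (with_proj G) \<and> is_P4 H)"

definition graph_complement :: "'a pair_pre_digraph \<Rightarrow> 'a pair_pre_digraph" where
  "graph_complement G =
     \<lparr> pverts = pverts G,
       parcs = {(u, v). u \<in> pverts G \<and> v \<in> pverts G \<and> u \<noteq> v \<and> (u, v) \<notin> parcs G} \<rparr>"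

definition contains_complete_bipartite :: "nat \<Rightarrow> nat \<Rightarrow> 'a pair_pre_digraph \<Rightarrow> bool" where
  "contains_complete_bipartite m n G \<longleftrightarrow>
     (\<exists>H. subgraph H (with_proj G) \<and> complete_bipartite_digraph m n H)"

lemma pair_graph_graph_complement:
  assumes "pair_graph G"
  shows "pair_graph (graph_complement G)"
proof -
  interpret pair_graph G by fact
  have "finite {(u, v). u \<in> pverts G \<and> v \<in> pverts G \<and> u \<noteq> v \<and> (u, v) \<notin> parcs G}"
    by (rule finite_subset[of _ "pverts G \<times> pverts G"]) auto
  moreover have "(v, u) \<in> parcs G" if "(u, v) \<in> parcs G" for u v
    using that by (rule arcs_symmetric)
  ultimately show ?thesis
    by unfold_locales (auto simp: graph_complement_def symmetric_def intro!: symI)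
qed

text \<open>
  A graph with fewer than two vertices contains no \<open>K\<^bsub>1,1\<^esub>\<close>, and neither does its complement.
  As \<open>\<lfloor>n / 6 + 1\<rfloor> = 1\<close> for \<open>n = 0\<close> and \<open>n = 1\<close>, a statement about \<open>K\<^bsub>t,t\<^esub>\<close> with
  \<open>t = \<lfloor>n / 6 + 1\<rfloor>\<close> needs \<open>n \<ge> 2\<close>.
\<close>

lemma not_contains_K11_small:
  assumes "pair_graph G" "card (pverts G) < 2"
  shows "\<not> contains_complete_bipartite 1 1 G"
    and "\<not> contains_complete_bipartite 1 1 (graph_complement G)"
proof -
  have *: False if F: "finite (pverts F)" "card (pverts F) < 2"
      and C: "contains_complete_bipartite 1 1 F" for F :: "'a pair_pre_digraph"
  proof -
    from C obtain H :: "('a, 'a \<times> 'a) pre_digraph" and U V where H: "verts H \<subseteq> verts (with_proj F)" "verts H = U \<union> V"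
      and UV: "U \<inter> V = {}" "card U = 1" "card V = 1"
      unfolding contains_complete_bipartite_def complete_bipartite_digraph_def subgraph_def
      by blast
    from UV have "finite U" "finite V" by (metis card.infinite zero_neq_one)+
    with UV have "card (U \<union> V) = 2" by (simp add: card_Un_disjoint)
    moreover have "card (U \<union> V) \<le> card (pverts F)"
      using H F(1) by (intro card_mono) simp_all
    ultimately show False using F(2) by simp
  qed
  interpret pair_graph G by fact
  show "\<not> contains_complete_bipartite 1 1 G"
    and "\<not> contains_complete_bipartite 1 1 (graph_complement G)"
    using *[of G] *[of "graph_complement G"] assms(2) pair_finite_verts
    unfolding graph_complement_def pair_pre_digraph.simps by blast+
qed

end

theory Submission
  imports Defs
begin

text \<open>
  A cograph on at least two vertices splits into two nonempty parts with either all or no edges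
  between them. Split repeatedly, always continuing inside the larger part and collecting the
  smaller parts in \<open>R\<close> or \<open>B\<close> according to the kind of split. Every collected vertex sees the current
  set \<open>V\<close> uniformly, so it suffices that \<open>R\<close> or \<open>B\<close> reaches size \<open>t\<close> while \<open>V\<close> still has size
  at least \<open>t\<close>. Just before this happens \<open>R\<close> and \<open>B\<close> have at most \<open>t - 1\<close> elements each, so
  \<open>V\<close> has at least \<open>n - 2 (t - 1) \<ge> 2 t - 1\<close> elements, and its larger part has at least \<open>t\<close>.
  This needs only \<open>n \<ge> 4 t - 3\<close> and \<open>n \<ge> 2\<close>, and \<open>n \<ge> 6 (t - 1)\<close> implies the former when \<open>t \<ge> 2\<close>.
\<close>

section \<open>Symmetric relations without induced paths on four vertices, and their splits\<close>

definition P4_free_on :: "('a \<Rightarrow> 'a \<Rightarrow> bool) \<Rightarrow> 'a set \<Rightarrow> bool" where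
  "P4_free_on E V \<longleftrightarrow> \<not> (\<exists>a\<in>V. \<exists>b\<in>V. \<exists>c\<in>V. \<exists>d\<in>V. distinct [a, b, c, d] \<and>
     E a b \<and> E b c \<and> E c d \<and> \<not> E a c \<and> \<not> E b d \<and> \<not> E a d)"

lemma P4_free_onD:
  assumes "P4_free_on E V" "a \<in> V" "b \<in> V" "c \<in> V" "d \<in> V" "distinct [a, b, c, d]"
    and "E a b" "E b c" "E c d" "\<not> E a c" "\<not> E b d" "\<not> E a d"
  shows False
  using assms unfolding P4_free_on_def by blast

lemma P4_free_on_subset: "P4_free_on E V \<Longrightarrow> W \<subseteq> V \<Longrightarrow> P4_free_on E W"
  unfolding P4_free_on_def by blast

text \<open>The complement of the path \<open>a b c d\<close> is the path \<open>b d a c\<close>.\<close>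

lemma P4_free_on_complement:
  assumes "symp E" "P4_free_on E V"
  shows "P4_free_on (\<lambda>x y. \<not> E x y) V"
  unfolding P4_free_on_def
proof (rule notI, elim bexE conjE)
  fix a b c d
  assume "a \<in> V" "b \<in> V" "c \<in> V" "d \<in> V" "distinct [a, b, c, d]" "\<not> E a b" "\<not> E b c" "\<not> E c d"
    and "\<not> \<not> E a c" "\<not> \<not> E b d" "\<not> \<not> E a d"
  moreover from this have "distinct [b, d, a, c]" "E d a" "\<not> E b a" "\<not> E d c"
    using assms(1) by (auto dest: sympD)
  ultimately show False
    using P4_free_onD[OF assms(2), of b d a c] by blast
qed

text \<open>For \<open>E\<close> this is a join; for the negated relation it is a disconnection.
  Relations are used instead of graphs so that complementation becomes pointwise negation and one
  argument serves both kinds of split.\<close>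

definition splits :: "('a \<Rightarrow> 'a \<Rightarrow> bool) \<Rightarrow> 'a set \<Rightarrow> 'a set \<Rightarrow> 'a set \<Rightarrow> bool" where
  "splits E V A C \<longleftrightarrow> A \<noteq> {} \<and> C \<noteq> {} \<and> A \<inter> C = {} \<and> A \<union> C = V \<and> (\<forall>x\<in>A. \<forall>y\<in>C. E x y)"

text \<open>If \<open>v\<close> has no neighbour on one side, it goes to the other side; if it is
  adjacent to all of \<open>W\<close>, it forms a part by itself. Otherwise its non-neighbours
  \<open>N\<close> have no edge to the remaining vertices: such an edge \<open>y x\<close> lies
  within one side, and a neighbour \<open>z\<close> of \<open>v\<close> on the other side completes
  an induced path \<open>y x v z\<close>.\<close>

lemma splits_insert:
  assumes sym: "symp E" and free: "P4_free_on E (insert v W)" and v: "v \<notin> W"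
    and AC: "splits (\<lambda>x y. \<not> E x y) W A C"
  shows "\<exists>A C. splits E (insert v W) A C \<or> splits (\<lambda>x y. \<not> E x y) (insert v W) A C"
proof -
  have symD: "E y x" if "E x y" for x y
    using sym that by (rule sympD)
  have W: "W = A \<union> C" "A \<noteq> {}" "C \<noteq> {}" "A \<inter> C = {}"
    and no: "\<And>x y. x \<in> A \<Longrightarrow> y \<in> C \<Longrightarrow> \<not> E x y" "\<And>x y. x \<in> A \<Longrightarrow> y \<in> C \<Longrightarrow> \<not> E y x"
    using AC symD unfolding splits_def by blast+
  define N where "N = {x \<in> W. \<not> E v x}"
  consider "\<forall>x\<in>A. \<not> E v x" | "\<forall>x\<in>C. \<not> E v x" | "N = {}"
    | a c where "a \<in> A" "E v a" "c \<in> C" "E v c" "N \<noteq> {}"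
    by blast
  then show ?thesis
  proof cases
    case 1
    then have "splits (\<lambda>x y. \<not> E x y) (insert v W) A (insert v C)"
      using W no v symD unfolding splits_def by blast
    then show ?thesis by blast
  next
    case 2
    then have "splits (\<lambda>x y. \<not> E x y) (insert v W) (insert v A) C"
      using W no v unfolding splits_def by blast
    then show ?thesis by blast
  next
    case 3
    then have "splits E (insert v W) {v} W"
      using W v unfolding splits_def N_def by blast
    then show ?thesis by blast
  next
    case 4
    have no_N: "\<not> E y x" if yx: "y \<in> N" "x \<in> W" "E v x" for x y
    proof
      assume "E y x"
      obtain z where z: "z \<in> W" "E v z" "\<not> E x z" "\<not> E y z" "x \<noteq> z" "y \<noteq> z"
      proof (cases "x \<in> A")
        case True
        then have "y \<in> A"
          using \<open>E y x\<close> no yx W unfolding N_def by blast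
        then show thesis using that[of c] 4 True W no \<open>y \<in> A\<close> by blast
      next
        case False
        then have "x \<in> C" "y \<in> C"
          using \<open>E y x\<close> no yx W unfolding N_def by blast+
        then show thesis using that[of a] 4 W no \<open>x \<in> C\<close> \<open>y \<in> C\<close> by blast
      qed
      have "distinct [y, x, v, z]"
        using z yx v unfolding N_def by auto
      moreover have "y \<in> W" "\<not> E y v" "E x v"
        using yx symD unfolding N_def by blast+
      ultimately show False
        using P4_free_onD[OF free, of y x v z] \<open>E y x\<close> z yx by blast
    qed
    have "\<not> E x v" if "x \<in> N" for x
      using that symD unfolding N_def by blast
    then have "splits (\<lambda>x y. \<not> E x y) (insert v W) N (insert v (W - N))"
      using 4 no_N v unfolding splits_def N_def by blast
    then show ?thesis by blast
  qed
qed

text \<open>The classical fact that a cograph on at least two vertices is disconnected or has a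
  disconnected complement, by adding one vertex at a time.\<close>

lemma P4_free_splits:
  assumes "symp E" "finite V" "P4_free_on E V" "card V \<ge> 2"
  shows "\<exists>A C. splits E V A C \<or> splits (\<lambda>x y. \<not> E x y) V A C"
  using assms(2-4)
proof (induction V rule: finite_induct)
  case empty
  then show ?case by simp
next
  case (insert v W)
  have symc: "symp (\<lambda>x y. \<not> E x y)"
    using assms(1) by (auto intro: sympI dest: sympD)
  show ?case
  proof (cases "card W \<ge> 2")
    case True
    then obtain A C where "splits E W A C \<or> splits (\<lambda>x y. \<not> E x y) W A C"
      using insert.IH P4_free_on_subset[OF insert.prems(1)] by blast
    \<comment> \<open>If \<open>W\<close> is a join, \<open>splits_insert\<close> is applied to the
      negated relation, and \<open>auto\<close> cancels the double negation.\<close>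
    then show ?thesis
      using splits_insert[OF assms(1) insert.prems(1) insert.hyps(2), of A C]
        splits_insert[OF symc P4_free_on_complement[OF assms(1) insert.prems(1)] insert.hyps(2), of A C]
      by auto
  next
    case False
    then have "card W = 1"
      using insert by simp
    then obtain w where "W = {w}"
      by (auto simp: card_1_singleton_iff)
    then have "splits E (insert v W) {v} W \<or> splits (\<lambda>x y. \<not> E x y) (insert v W) {v} W"
      using insert.hyps(2) unfolding splits_def by auto
    then show ?thesis by blast
  qed
qed

section \<open>Bicliques from repeated splitting\<close>

definition biclique :: "('a \<Rightarrow> 'a \<Rightarrow> bool) \<Rightarrow> nat \<Rightarrow> 'a set \<Rightarrow> bool" where
  "biclique E t S \<longleftrightarrow> (\<exists>X Y. X \<subseteq> S \<and> Y \<subseteq> S \<and> X \<inter> Y = {} \<and> card X = t \<and> card Y = t \<and>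
     (\<forall>x\<in>X. \<forall>y\<in>Y. E x y))"

lemma bicliqueI:
  assumes "X \<subseteq> S" "Y \<subseteq> S" "X \<inter> Y = {}" "t \<le> card X" "t \<le> card Y" "\<And>x y. x \<in> X \<Longrightarrow> y \<in> Y \<Longrightarrow> E x y"
  shows "biclique E t S"
proof -
  obtain X' Y' where "X' \<subseteq> X" "card X' = t" "Y' \<subseteq> Y" "card Y' = t"
    using assms(4,5) by (metis obtain_subset_with_card_n)
  moreover from this have "X' \<subseteq> S" "Y' \<subseteq> S" "X' \<inter> Y' = {}" "\<forall>x\<in>X'. \<forall>y\<in>Y'. E x y"
    using assms(1-3,6) by blast+
  ultimately show ?thesis
    unfolding biclique_def by (intro exI[of _ X'] exI[of _ Y'] conjI)
qed

lemma splits_largerE: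
  assumes "symp E" "finite V" "splits E V A C"
  obtains A' C' where "splits E V A' C'" "card C' \<le> card A'" "card A' + card C' = card V" "card C' > 0"
proof -
  have "splits E V C A"
    using assms(1,3) unfolding splits_def by (auto dest: sympD)
  moreover have "card A + card C = card V" "card A > 0" "card C > 0"
    using assms(2,3) unfolding splits_def by (auto simp: card_Un_disjoint card_gt_0_iff)
  ultimately show thesis
    using that[of A C] that[of C A] assms(3) by linarith
qed

text \<open>Each round moves the smaller part from \<open>V\<close> to \<open>R\<close> or
  \<open>B\<close>, so \<open>card V + card R + card B\<close> never changes. The induction
  generalises over \<open>E\<close> as well, since a disconnection is treated as a join of the
  negated relation with \<open>R\<close> and \<open>B\<close> exchanged.\<close>

lemma biclique_of_split_sequence:
  assumes "symp E" "finite S" "P4_free_on E V" "V \<subseteq> S" "R \<subseteq> S" "B \<subseteq> S"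
    and "R \<inter> V = {}" "B \<inter> V = {}" "card R < t" "card B < t"
    and "4 * t \<le> card V + card R + card B + 3" "2 \<le> card V"
    and "\<And>x y. x \<in> R \<Longrightarrow> y \<in> V \<Longrightarrow> E x y" "\<And>x y. x \<in> B \<Longrightarrow> y \<in> V \<Longrightarrow> \<not> E x y"
  shows "biclique E t S \<or> biclique (\<lambda>x y. \<not> E x y) t S"
  using assms
proof (induction "card V" arbitrary: E V R B rule: less_induct)
  case less
  have symc: "symp (\<lambda>x y. \<not> E x y)"
    using less.prems(1) by (auto intro: sympI dest: sympD)
  have step: "biclique F t S \<or> biclique (\<lambda>x y. \<not> F x y) t S"
    if F: "symp F" "P4_free_on F V" "splits F V A C" and PQ: "P \<subseteq> S" "Q \<subseteq> S" "P \<inter> V = {}" "Q \<inter> V = {}"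
      "card P < t" "card Q < t" "4 * t \<le> card V + card P + card Q + 3"
      "\<And>x y. x \<in> P \<Longrightarrow> y \<in> V \<Longrightarrow> F x y" "\<And>x y. x \<in> Q \<Longrightarrow> y \<in> V \<Longrightarrow> \<not> F x y"
    for F A C P Q
  proof -
    have fin: "finite V" "finite P"
      using less.prems(2,4) PQ(1) finite_subset by blast+
    obtain A' C' where AC: "splits F V A' C'" "card C' \<le> card A'" "card A' + card C' = card V" "card C' > 0"
      using splits_largerE[OF F(1) fin(1) F(3)] by blast
    have sub: "A' \<subseteq> V" "C' \<subseteq> V" "A' \<inter> C' = {}" "\<And>x y. x \<in> C' \<Longrightarrow> y \<in> A' \<Longrightarrow> F x y"
      using AC(1) F(1) unfolding splits_def by (auto dest: sympD)
    have card_P: "card (P \<union> C') = card P + card C'"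
      using fin sub(2) PQ(3) by (intro card_Un_disjoint) (auto intro: finite_subset)
    have adj: "\<And>x y. x \<in> P \<union> C' \<Longrightarrow> y \<in> A' \<Longrightarrow> F x y"
      using sub PQ(8) by blast
    show ?thesis
    proof (cases "t \<le> card (P \<union> C')")
      case True
      have "t \<le> card A'"
        using PQ(5-7) AC(2,3) by linarith
      then have "biclique F t S"
        using True adj sub PQ less.prems(4) by (intro bicliqueI[of "P \<union> C'" _ A']) blast+
      then show ?thesis ..
    next
      case False
      \<comment> \<open>As \<open>C'\<close> is nonempty and
        \<open>card (P \<union> C') < t\<close>, \<open>t\<close> is at least 2. Hence
        \<open>A'\<close> keeps at least 2t - 1 >= 3 vertices and can be split again.\<close>
      then have "card A' \<ge> 2"
        using PQ(5-7) AC(2-4) card_P by linarith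
      then show ?thesis
        using F(1) P4_free_on_subset[OF F(2) sub(1)] sub PQ adj AC card_P less.prems(2,4) False
        by (intro less.hyps[of A' F "P \<union> C'" Q]) (linarith | blast)+
    qed
  qed
  have "finite V"
    using less.prems(2,4) finite_subset by blast
  then obtain A C where "splits E V A C \<or> splits (\<lambda>x y. \<not> E x y) V A C"
    using P4_free_splits less.prems(1,3,12) by blast
  then show ?case
  proof
    assume "splits E V A C"
    then show ?thesis
      using step[of E A C R B] less.prems by blast
  next
    assume "splits (\<lambda>x y. \<not> E x y) V A C"
    then have "biclique (\<lambda>x y. \<not> E x y) t S \<or> biclique (\<lambda>x y. \<not> \<not> E x y) t S"
      using less.prems P4_free_on_complement[OF less.prems(1,3)]
      by (intro step[OF symc, of A C B R]) (auto simp: add_ac)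
    then show ?thesis by auto
  qed
qed

lemma P4_free_biclique:
  assumes "symp E" "finite V" "P4_free_on E V" "2 \<le> card V" "4 * t \<le> card V + 3"
  shows "biclique E t V \<or> biclique (\<lambda>x y. \<not> E x y) t V"
proof (cases "t = 0")
  \<comment> \<open>For \<open>t = 0\<close> the strict bounds on \<open>card R\<close> and
    \<open>card B\<close> fail even for empty sets.\<close>
  case True
  then have "biclique E t V"
    by (intro bicliqueI[of "{}" _ "{}"]) auto
  then show ?thesis ..
next
  case False
  then show ?thesis
    using assms biclique_of_split_sequence[of E V V "{}" "{}" t] by simp
qed

section \<open>From relations back to graphs\<close>

lemma cograph_P4_free_on:
  assumes "cograph G"
  shows "P4_free_on (\<lambda>x y. (x, y) \<in> parcs G) (pverts G)"
  unfolding P4_free_on_def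
proof clarify
  fix a b c d
  assume V: "a \<in> pverts G" "b \<in> pverts G" "c \<in> pverts G" "d \<in> pverts G"
    and dist: "distinct [a, b, c, d]"
    and E: "(a, b) \<in> parcs G" "(b, c) \<in> parcs G" "(c, d) \<in> parcs G"
    and nE: "(a, c) \<notin> parcs G" "(b, d) \<notin> parcs G" "(a, d) \<notin> parcs G"
  interpret pair_graph G
    using assms by (simp add: cograph_def)
  let ?E = "{(a, b), (b, a), (b, c), (c, b), (c, d), (d, c)}"
  let ?H = "\<lparr>pverts = {a, b, c, d}, parcs = ?E\<rparr>"
  have loop: "(x, x) \<notin> parcs G" for x
    using pair_no_loops by fastforce
  have E': "(b, a) \<in> parcs G" "(c, b) \<in> parcs G" "(d, c) \<in> parcs G"
    using E by (simp_all add: arcs_symmetric)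
  have nE': "(c, a) \<notin> parcs G" "(d, b) \<notin> parcs G" "(d, a) \<notin> parcs G"
    using nE arcs_symmetric by blast+
  interpret H: pair_graph ?H
    using dist by unfold_locales (auto simp: symmetric_def intro!: symI)
  have "subgraph (with_proj ?H) (with_proj G)"
    using V E E' wf_digraph H.wf_digraph by (auto simp: subgraph_def)
  \<comment> \<open>Of the sixteen ordered pairs from the four vertices, six are the path arcs; the
    other ten are four loops and six non-arcs.\<close>
  moreover have "?E = {e \<in> parcs G. fst e \<in> {a, b, c, d} \<and> snd e \<in> {a, b, c, d}}"
  proof (intro subset_antisym subrelI)
    fix x y
    assume "(x, y) \<in> {e \<in> parcs G. fst e \<in> {a, b, c, d} \<and> snd e \<in> {a, b, c, d}}"
    then have "x \<in> {a, b, c, d}" "y \<in> {a, b, c, d}" "(x, y) \<in> parcs G"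
      by simp_all
    then show "(x, y) \<in> ?E"
      by (elim insertE emptyE) (simp_all add: nE nE' loop)
  next
    fix x y
    assume "(x, y) \<in> ?E"
    then show "(x, y) \<in> {e \<in> parcs G. fst e \<in> {a, b, c, d} \<and> snd e \<in> {a, b, c, d}}"
      by (elim insertE emptyE Pair_inject) (simp_all add: E E')
  qed
  ultimately have "induced_subgraph (with_proj ?H) (with_proj G)"
    by (simp add: induced_subgraph_def)
  moreover have "graph (with_proj ?H)"
    by unfold_locales
  then have "is_P4 (with_proj ?H)"
    using dist unfolding is_P4_def by (intro conjI exI[of _ a] exI[of _ b] exI[of _ c] exI[of _ d]) simp_all
  ultimately show False
    using assms unfolding cograph_def by blast
qed

text \<open>The relation has to yield arcs only between distinct vertices, because non-adjacency
  also holds on the diagonal, where the complement has no arc. Disjointness of the two sides makes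
  this enough.\<close>

lemma contains_complete_bipartiteI:
  assumes "pair_graph G" "biclique E t (pverts G)"
    and "\<And>x y. x \<in> pverts G \<Longrightarrow> y \<in> pverts G \<Longrightarrow> x \<noteq> y \<Longrightarrow> E x y \<Longrightarrow> (x, y) \<in> parcs G"
  shows "contains_complete_bipartite t t G"
proof -
  obtain X Y where XY: "X \<subseteq> pverts G" "Y \<subseteq> pverts G" "X \<inter> Y = {}" "card X = t" "card Y = t"
    and adj: "\<forall>x\<in>X. \<forall>y\<in>Y. E x y"
    using assms(2) unfolding biclique_def by (elim exE conjE)
  have XY_arcs: "X \<times> Y \<subseteq> parcs G"
    using XY adj assms(3) by blast
  interpret pair_graph G by fact
  let ?H = "\<lparr>pverts = X \<union> Y, parcs = X \<times> Y \<union> Y \<times> X\<rparr>"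
  have "finite (X \<union> Y)"
    using XY(1,2)[THEN finite_subset, OF pair_finite_verts] by simp
  then have K: "complete_bipartite_digraph t t (with_proj ?H)"
    using XY(3-5) unfolding complete_bipartite_digraph_pair_def
    by (intro conjI exI[of _ X] exI[of _ Y]) simp_all
  interpret H: pair_graph ?H
    by (rule pair_graphI_complete_bipartite[OF K])
  have "Y \<times> X \<subseteq> parcs G"
    using XY_arcs arcs_symmetric by auto
  then have "subgraph (with_proj ?H) (with_proj G)"
    using XY XY_arcs wf_digraph H.wf_digraph by (auto simp: subgraph_def)
  with K show ?thesis
    unfolding contains_complete_bipartite_def by blast
qed

theorem corollary1:
  fixes n t :: nat and G :: "'a pair_pre_digraph"
  assumes "n \<ge> 2"
    and "t = nat \<lfloor>real n / 6 + 1\<rfloor>"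
    and "cograph G"
    and "card (pverts G) = n"
  shows "contains_complete_bipartite t t G \<or> contains_complete_bipartite t t (graph_complement G)"
proof -
  let ?E = "\<lambda>x y. (x, y) \<in> parcs G"
  have G: "pair_graph G"
    using assms(3) by (simp add: cograph_def)
  interpret pair_graph G by fact
  have sym: "symp ?E"
    by (auto intro: sympI arcs_symmetric)
  have "real t \<le> real n / 6 + 1"
    unfolding assms(2) by linarith
  then have "6 * t \<le> n + 6"
    by linarith
  \<comment> \<open>For t >= 2 this follows from the previous bound, since then 4t <= 6t - 3; for t
    = 1 it comes from \<open>n \<ge> 2\<close>.\<close>
  then have "4 * t \<le> n + 3"
    using assms(1) by presburger
  then have "biclique ?E t (pverts G) \<or> biclique (\<lambda>x y. \<not> ?E x y) t (pverts G)"
    using P4_free_biclique[OF sym pair_finite_verts cograph_P4_free_on[OF assms(3)]] assms(1,4) by simp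
  then show ?thesis
  proof
    assume "biclique ?E t (pverts G)"
    then show ?thesis
      using contains_complete_bipartiteI[OF G] by blast
  next
    assume "biclique (\<lambda>x y. \<not> ?E x y) t (pverts G)"
    then have "biclique (\<lambda>x y. \<not> ?E x y) t (pverts (graph_complement G))"
      by (simp add: graph_complement_def)
    then have "contains_complete_bipartite t t (graph_complement G)"
      using sym by (intro contains_complete_bipartiteI[OF pair_graph_graph_complement[OF G]])
        (auto simp: graph_complement_def intro: sympI dest: sympD)
    then show ?thesis ..
  qed
qed

end
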